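(* Let $1\le N\le M$ be integers, let $z_1,\dots,z_N$ be free variables and $t$ a nonzero free parameter. For every hole configuration $1\le \overline{x_1}<\cdots<\overline{x_N}\le M$, the dual wavefunction $\langle \Phi(z_1,\dots,z_N)|\overline{x_1}\cdots\overline{x_N}\rangle$ is expressed by the Schur polynomials as $$\langle \Phi(z_1,\dots,z_N)|\overline{x_1}\cdots\overline{x_N}\rangle = t^{N(M-N)}\prod_{1\le j<k\le N}(z_j+tz_k)\; s_{\overline{\lambda}}\Big(\frac{z_1}{t},\dots,\frac{z_N}{t}\Big),$$ where $\overline{\lambda}=(\overline{\lambda_1},\dots,\overline{\lambda_N})$ is the Young diagram with $\overline{\lambda_j}=\overline{x_{N-j+1}}-N+j-1$, $j=1,\dots,N$.
   Context: $W_a$ (auxiliary space) and $\mathcal F_j$, $j=1,\dots,M$ (quantum spaces) are copies of $\mathbb C^2$ with basis $|0\rangle,|1\rangle$ and dual basis $\langle 0|,\langle 1|$. The $L$-operator $L_{aj}(z,t)$ acts on $W_a\otimes\mathcal F_j$ with matrix elements $[L]_{\alpha\beta}^{\gamma\delta}={}_a\langle\gamma|{}_j\langle\delta|L_{aj}(z,t)|\alpha\rangle_a|\beta\rangle_j$ given by $[L]_{00}^{00}=1$, $[L]_{01}^{01}=t$, $[L]_{10}^{01}=1$, $[L]_{01}^{10}=(t+1)z$, $[L]_{10}^{10}=z$, $[L]_{11}^{11}=z$, and all others $0$. The $B$-operator on $\mathcal F_1\otimes\cdots\otimes\mathcal F_M$ is $B(z)={}_a\langle 0|L_{aM}(z,t)\cdots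 L_{a1}(z,t)|1\rangle_a$. $\langle 1\cdots M|={}_1\langle 1|\otimes\cdots\otimes{}_M\langle 1|$. For $1\le\overline{x_1}<\cdots<\overline{x_N}\le M$, $|\overline{x_1}\cdots\overline{x_N}\rangle$ is the basis vector of $\mathcal F_1\otimes\cdots\otimes\mathcal F_M$ whose tensor factor is $|0\rangle$ (hole) at sites $\overline{x_1},\dots,\overline{x_N}$ and $|1\rangle$ at all other sites. The dual wavefunction is $\langle \Phi(z_1,\dots,z_N)|\overline{x_1}\cdots\overline{x_N}\rangle=\langle 1\cdots M|B(z_1)\cdots B(z_N)|\overline{x_1}\cdots\overline{x_N}\rangle$. The Schur polynomial for $\lambda=(\lambda_1\ge\cdots\ge\lambda_N\ge0)$ is $s_\lambda(z_1,\dots,z_N)=\det_{1\le j,k\le N}(z_j^{\lambda_k+N-k})/\prod_{1\le j<k\le N}(z_j-z_k)$. *)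

theory Defs
  imports
    Complex_Main
    "HOL-Library.FuncSet"
    "HOL-Library.Poly_Mapping"
    "Jordan_Normal_Form.Determinant"
begin

section \<open>The L-operator and the B-operator\<close>

text \<open>
  The basis vectors of \<open>F\<^sub>1 \<otimes> \<dots> \<otimes> F\<^sub>M\<close> are indexed by the configurations in \<open>configs M\<close>:
  \<open>n j = 0\<close> is a hole and \<open>n j = 1\<close> a particle at site \<open>j\<close>. A vector is given by its
  coordinates, i.e. as a function on configurations vanishing outside \<open>configs M\<close>; a vector of
  \<open>W\<^sub>a \<otimes> F\<^sub>1 \<otimes> \<dots> \<otimes> F\<^sub>M\<close> has the auxiliary basis index in \<open>{0, 1}\<close> as its first argument.
  All operators below preserve these supports when the sites involved lie in \<open>{1..M}\<close>.
\<close>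

type_synonym config = "nat \<Rightarrow> nat"
type_synonym qvec = "config \<Rightarrow> complex"
type_synonym aqvec = "nat \<Rightarrow> config \<Rightarrow> complex"

definition configs :: "nat \<Rightarrow> config set" where
  "configs M = {1..M} \<rightarrow>\<^sub>E {0, 1}"

definition ket :: "config \<Rightarrow> qvec" where
  "ket n = (\<lambda>m. if m = n then 1 else 0)"

definition bra :: "config \<Rightarrow> qvec \<Rightarrow> complex" where
  "bra n \<psi> = \<psi> n"

text \<open>
  \<open>L_elem z t \<alpha> \<beta> \<gamma> \<delta>\<close> is the matrix element \<open>[L]\<close> with lower (input) indices \<open>\<alpha> \<beta>\<close> and upper
  (output) indices \<open>\<gamma> \<delta>\<close>; in each pair the auxiliary index comes first.
\<close>

definition L_elem :: "complex \<Rightarrow> complex \<Rightarrow> nat \<Rightarrow> nat \<Rightarrow> nat \<Rightarrow> nat \<Rightarrow> complex" where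
  "L_elem z t \<alpha> \<beta> \<gamma> \<delta> =
    (if (\<alpha>, \<beta>, \<gamma>, \<delta>) = (0, 0, 0, 0) then 1
     else if (\<alpha>, \<beta>, \<gamma>, \<delta>) = (0, 1, 0, 1) then t
     else if (\<alpha>, \<beta>, \<gamma>, \<delta>) = (1, 0, 0, 1) then 1
     else if (\<alpha>, \<beta>, \<gamma>, \<delta>) = (0, 1, 1, 0) then (t + 1) * z
     else if (\<alpha>, \<beta>, \<gamma>, \<delta>) = (1, 0, 1, 0) then z
     else if (\<alpha>, \<beta>, \<gamma>, \<delta>) = (1, 1, 1, 1) then z
     else 0)"

text \<open>\<open>L_op j z t\<close> acts by \<open>L\<^sub>a\<^sub>j(z, t)\<close> on \<open>W\<^sub>a \<otimes> F\<^sub>j\<close> and as the identity on the other factors.\<close>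

definition L_op :: "nat \<Rightarrow> complex \<Rightarrow> complex \<Rightarrow> aqvec \<Rightarrow> aqvec" where
  "L_op j z t \<Psi> =
    (\<lambda>\<gamma> n. \<Sum>\<alpha>\<in>{0, 1}. \<Sum>\<beta>\<in>{0, 1}. L_elem z t \<alpha> \<beta> \<gamma> (n j) * \<Psi> \<alpha> (n(j := \<beta>)))"

text \<open>The product \<open>L\<^sub>a\<^sub>M \<cdots> L\<^sub>a\<^sub>1\<close>; the factor at site 1 is applied first.\<close>

definition monodromy :: "nat \<Rightarrow> complex \<Rightarrow> complex \<Rightarrow> aqvec \<Rightarrow> aqvec" where
  "monodromy M z t = fold (\<lambda>j. L_op j z t) [1..<Suc M]"

definition aux_ket :: "nat \<Rightarrow> qvec \<Rightarrow> aqvec" where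
  "aux_ket \<alpha> \<psi> = (\<lambda>\<gamma> n. if \<gamma> = \<alpha> then \<psi> n else 0)"

definition aux_bra :: "nat \<Rightarrow> aqvec \<Rightarrow> qvec" where
  "aux_bra \<gamma> \<Psi> = \<Psi> \<gamma>"

definition B_op :: "nat \<Rightarrow> complex \<Rightarrow> complex \<Rightarrow> qvec \<Rightarrow> qvec" where
  "B_op M z t \<psi> = aux_bra 0 (monodromy M z t (aux_ket 1 \<psi>))"


section \<open>The dual wavefunction\<close>

definition all_particles :: "nat \<Rightarrow> config" where
  "all_particles M = (\<lambda>i\<in>{1..M}. 1)"

definition hole_config :: "nat \<Rightarrow> nat set \<Rightarrow> config" where
  "hole_config M X = (\<lambda>i\<in>{1..M}. if i \<in> X then 0 else 1)"

definition dual_wavefunction ::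
  "nat \<Rightarrow> nat \<Rightarrow> complex \<Rightarrow> (nat \<Rightarrow> complex) \<Rightarrow> (nat \<Rightarrow> nat) \<Rightarrow> complex" where
  "dual_wavefunction M N t z x =
    bra (all_particles M)
      (foldr (\<lambda>j. B_op M (z j) t) [1..<Suc N] (ket (hole_config M (x ` {1..N}))))"


section \<open>Schur polynomials\<close>

text \<open>
  Polynomials over the complex numbers in the variables \<open>X\<^sub>i\<close>, \<open>i\<close> a natural number, are finitely
  supported functions from exponent vectors to coefficients. The instance of the integral domain
  class is the one from the library.
\<close>

type_synonym mpoly = "(nat \<Rightarrow>\<^sub>0 nat) \<Rightarrow>\<^sub>0 complex"

definition Var :: "nat \<Rightarrow> mpoly" where
  "Var i = Poly_Mapping.single (Poly_Mapping.single i 1) 1"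

definition eval_mpoly :: "(nat \<Rightarrow> complex) \<Rightarrow> mpoly \<Rightarrow> complex" where
  "eval_mpoly z p =
    (\<Sum>m\<in>Poly_Mapping.keys p.
       Poly_Mapping.lookup p m * (\<Prod>i\<in>Poly_Mapping.keys m. z i ^ Poly_Mapping.lookup m i))"

text \<open>
  Matrix indices start at 0 in the library, so that the entry at \<open>(j, k)\<close> below is the power of
  \<open>X\<^sub>j\<^sub>+\<^sub>1\<close> with exponent \<open>\<lambda>\<^sub>k\<^sub>+\<^sub>1 + N - (k + 1)\<close>.
\<close>

definition alternant :: "nat \<Rightarrow> (nat \<Rightarrow> nat) \<Rightarrow> mpoly" where
  "alternant N lam =
    det (mat N N (\<lambda>(j, k). Var (Suc j) ^ (lam (Suc k) + (N - Suc k))))"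

definition vandermonde :: "nat \<Rightarrow> mpoly" where
  "vandermonde N = (\<Prod>j\<in>{1..N}. \<Prod>k\<in>{j<..N}. Var j - Var k)"

text \<open>
  The quotient of the two polynomials above: it is exact, and unique because the polynomials form
  an integral domain. Taking the quotient among polynomials rather than among their values makes
  \<open>schur_poly\<close> meaningful also at points with coinciding coordinates.
\<close>

definition schur_poly :: "nat \<Rightarrow> (nat \<Rightarrow> nat) \<Rightarrow> mpoly" where
  "schur_poly N lam = (THE s. s * vandermonde N = alternant N lam)"

text \<open>
  The Young diagram of a hole configuration. Since \<open>x (N - j + 1) \<ge> N - j + 1\<close> for
  \<open>j\<close> in \<open>{1..N}\<close>, the subtraction of natural numbers does not truncate.
\<close>

definition hole_partition :: "nat \<Rightarrow> (nat \<Rightarrow> nat) \<Rightarrow> nat \<Rightarrow> nat" where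
  "hole_partition N x j = x (N - j + 1) + j - N - 1"

end

theory Submission
  imports Defs
begin

text \<open>
  Put \<open>u\<^sub>j = z\<^sub>j / t\<close>. After multiplication by the Vandermonde product in the \<open>u\<^sub>j\<close>, the claim says that the
  wavefunction is, up to an explicit factor, the determinant of the powers \<open>u\<^sub>j\<^sup>x\<^sup>-\<^sup>1\<close>, where \<open>x\<close> runs
  through the holes. This is shown by induction on \<open>N\<close>: the innermost operator \<open>B(z\<^sub>N)\<close> turns the
  determinant of size \<open>N - 1\<close>, summed over all output configurations, into the one of size \<open>N\<close>.
  The sum is evaluated site by site, carrying the sums for both values of the auxiliary index; both
  are determinants in which all holes met so far occupy one row each, and the weights of the
  \<open>L\<close>-operator make them satisfy the same recursion, by linearity in one row and vanishing for
  repeated rows. Cancelling the Vandermonde product requires distinct \<open>z\<^sub>j\<close>; the remaining points are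
  reached by continuity.
\<close>

section \<open>Evaluation and Schur polynomials\<close>

lemma eval_mpoly_superset:
  assumes "finite A" "Poly_Mapping.keys p \<subseteq> A"
  shows "eval_mpoly z p =
    (\<Sum>m\<in>A. Poly_Mapping.lookup p m * (\<Prod>i\<in>Poly_Mapping.keys m. z i ^ Poly_Mapping.lookup m i))"
  unfolding eval_mpoly_def
  by (rule sum.mono_neutral_left) (use assms in \<open>auto simp: in_keys_iff\<close>)

lemma eval_mpoly_add: "eval_mpoly z (p + q) = eval_mpoly z p + eval_mpoly z q"
proof -
  let ?A = "Poly_Mapping.keys p \<union> Poly_Mapping.keys q"
  have "Poly_Mapping.keys (p + q) \<subseteq> ?A"
    by (rule keys_add)
  then show ?thesis
    by (simp add: eval_mpoly_superset[of ?A] lookup_add distrib_right sum.distrib)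
qed

lemma eval_mpoly_zero: "eval_mpoly z 0 = 0"
  by (simp add: eval_mpoly_def)

lemma eval_mpoly_sum: "eval_mpoly z (sum f A) = (\<Sum>a\<in>A. eval_mpoly z (f a))"
  by (induction A rule: infinite_finite_induct) (simp_all add: eval_mpoly_zero eval_mpoly_add)

lemma eval_mpoly_single:
  "eval_mpoly z (Poly_Mapping.single m a) =
    a * (\<Prod>i\<in>Poly_Mapping.keys m. z i ^ Poly_Mapping.lookup m i)"
  by (subst eval_mpoly_superset[of "{m}"]) auto

lemma prod_keys_add:
  fixes z :: "'a \<Rightarrow> 'b :: comm_semiring_1"
  shows "(\<Prod>i\<in>Poly_Mapping.keys (m + n). z i ^ Poly_Mapping.lookup (m + n) i) =
    (\<Prod>i\<in>Poly_Mapping.keys m. z i ^ Poly_Mapping.lookup m i) *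
    (\<Prod>i\<in>Poly_Mapping.keys n. z i ^ Poly_Mapping.lookup n i)"
proof -
  let ?A = "Poly_Mapping.keys m \<union> Poly_Mapping.keys n"
  have *: "(\<Prod>i\<in>Poly_Mapping.keys k. z i ^ Poly_Mapping.lookup k i) =
      (\<Prod>i\<in>?A. z i ^ Poly_Mapping.lookup k i)" if "Poly_Mapping.keys k \<subseteq> ?A" for k
    by (rule prod.mono_neutral_left) (use that in \<open>auto simp: in_keys_iff\<close>)
  show ?thesis
    unfolding *[OF keys_add] *[OF Un_upper1] *[OF Un_upper2]
    by (simp add: lookup_add power_add prod.distrib)
qed

lemma poly_mapping_sum_single:
  "p = (\<Sum>m\<in>Poly_Mapping.keys p. Poly_Mapping.single m (Poly_Mapping.lookup p m))"
  by (rule poly_mapping_eqI)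
    (auto simp: lookup_sum lookup_single when_def in_keys_iff)

lemma eval_mpoly_mult: "eval_mpoly z (p * q) = eval_mpoly z p * eval_mpoly z q"
proof -
  have "p * q = (\<Sum>m\<in>Poly_Mapping.keys p. \<Sum>n\<in>Poly_Mapping.keys q.
      Poly_Mapping.single (m + n) (Poly_Mapping.lookup p m * Poly_Mapping.lookup q n))"
    using arg_cong2[OF poly_mapping_sum_single[of p] poly_mapping_sum_single[of q], of "(*)"]
    by (simp add: sum_product mult_single)
  then show ?thesis
    by (simp add: eval_mpoly_sum eval_mpoly_single prod_keys_add)
      (simp add: eval_mpoly_def sum_product ac_simps)
qed

lemma eval_mpoly_one: "eval_mpoly z 1 = 1"
  by (simp add: eval_mpoly_single flip: single_one)

lemma comm_ring_hom_eval_mpoly: "comm_ring_hom (eval_mpoly z)"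
  by unfold_locales
    (simp_all add: eval_mpoly_zero eval_mpoly_one eval_mpoly_add eval_mpoly_mult)

lemma eval_mpoly_Var: "eval_mpoly z (Var i) = z i"
  by (simp add: Var_def eval_mpoly_single)

lemma continuous_on_eval_mpoly:
  assumes "\<And>i. continuous_on S (\<lambda>x. f x i)"
  shows "continuous_on S (\<lambda>x. eval_mpoly (f x) p)"
  unfolding eval_mpoly_def by (intro continuous_intros assms)

lemma eval_mpoly_vandermonde:
  "eval_mpoly z (vandermonde N) = (\<Prod>j\<in>{1..N}. \<Prod>k\<in>{j<..N}. z j - z k)"
proof -
  interpret comm_ring_hom "eval_mpoly z" by (rule comm_ring_hom_eval_mpoly)
  show ?thesis
    by (simp add: vandermonde_def hom_distribs eval_mpoly_Var)
qed

lemma eval_mpoly_alternant: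
  "eval_mpoly z (alternant N lam) =
    det (mat N N (\<lambda>(j, k). z (Suc j) ^ (lam (Suc k) + (N - Suc k))))"
proof -
  interpret comm_ring_hom "eval_mpoly z" by (rule comm_ring_hom_eval_mpoly)
  show ?thesis
    unfolding alternant_def hom_det[symmetric]
    by (rule arg_cong[of _ _ det]) (auto simp: hom_distribs eval_mpoly_Var)
qed

section \<open>Exact division of alternants by the Vandermonde product\<close>

lemma vandermonde_nonzero: "vandermonde N \<noteq> 0"
proof
  assume "vandermonde N = 0"
  \<comment> \<open>The coordinates of this point are pairwise distinct, so no factor of the product
    vanishes.\<close>
  then have "eval_mpoly of_nat (vandermonde N) = 0"
    by (simp add: eval_mpoly_zero)
  then show False
    by (auto simp: eval_mpoly_vandermonde)
qed

text \<open>Arbitrary polynomials in place of monomials let the induction close: dividing each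
  \<open>p k\<close> by X - \<open>a n\<close> leaves quotients of no special form.\<close>

lemma det_eval_dvd:
  fixes a :: "nat \<Rightarrow> 'a :: comm_ring_1"
  shows "(\<Prod>j<n. \<Prod>k\<in>{j<..<n}. a j - a k) dvd det (mat n n (\<lambda>(j, k). poly (p k) (a j)))"
proof (induction n arbitrary: p)
  case 0
  show ?case by simp
next
  case (Suc n)
  define q where "q k = synthetic_div (p k) (a n)" for k
  have q: "poly (p k) x = (x - a n) * poly (q k) x + poly (p k) (a n)" for k x
    using arg_cong[OF synthetic_div_correct'[of "a n" "p k"], of "\<lambda>r. poly r x"]
    by (simp add: q_def algebra_simps)
  define A where "A = mat (Suc n) (Suc n) (\<lambda>(j, k). poly (p k) (a j))"
  define F where "F = (\<lambda>j. if j < n then a j - a n else 1)"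
  define B where "B = mat (Suc n) (Suc n)
    (\<lambda>(j, k). if j < n then poly (q k) (a j) else poly (p k) (a n))"
  \<comment> \<open>\<open>C\<close> encodes the row operation: row \<open>j < n\<close> of
    \<open>A\<close> is \<open>a j - a n\<close> times row \<open>j\<close> of \<open>B\<close> plus
    the common last row.\<close>
  define C where "C = mat (Suc n) (Suc n)
    (\<lambda>(j, k). if j = k then F j else if k = n then 1 else 0)"
  have A: "A \<in> carrier_mat (Suc n) (Suc n)" and B: "B \<in> carrier_mat (Suc n) (Suc n)"
    and C: "C \<in> carrier_mat (Suc n) (Suc n)" by (auto simp: A_def B_def C_def)
  have "A = C * B"
  proof (rule eq_matI)
    fix j k assume jk: "j < dim_row (C * B)" "k < dim_col (C * B)"
    have "(C * B) $$ (j, k) = (\<Sum>i<Suc n. C $$ (j, i) * B $$ (i, k))"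
      using jk B C by (simp add: scalar_prod_def lessThan_atLeast0 B_def C_def)
    also have "\<dots> = (\<Sum>i<n. (if i = j then F j * B $$ (i, k) else 0)) + B $$ (n, k)"
    proof -
      have "C $$ (j, i) * B $$ (i, k) = (if i = j then F j * B $$ (i, k) else 0)" if "i < n" for i
        using that jk C by (auto simp: C_def)
      moreover have "C $$ (j, n) = 1"
        using jk C by (auto simp: C_def F_def)
      ultimately show ?thesis by simp
    qed
    also have "\<dots> = A $$ (j, k)"
      using jk q[of k "a j"] B C by (auto simp: A_def B_def F_def less_Suc_eq)
    finally show "A $$ (j, k) = (C * B) $$ (j, k)" by simp
  qed (use A B C in auto)
  then have "det A = det C * det B" using B C by (simp add: det_mult)
  moreover have "det C = (\<Prod>j<n. a j - a n)"
  proof -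
    have "det C = prod_list (diag_mat C)"
      by (rule det_upper_triangular[OF _ C]) (auto simp: C_def upper_triangular_def)
    also have "\<dots> = (\<Prod>j<Suc n. F j)"
    proof -
      have "diag_mat C = map F [0..<Suc n]"
        by (auto simp: diag_mat_def C_def)
      then show ?thesis
        by (simp only: prod.distinct_set_conv_list[symmetric] distinct_upt set_upt lessThan_atLeast0)
    qed
    finally show ?thesis by (simp add: F_def)
  qed
  moreover have "(\<Prod>j<n. \<Prod>k\<in>{j<..<n}. a j - a k) dvd det B"
    unfolding laplace_expansion_row[OF B lessI]
  proof (intro dvd_sum dvd_mult)
    fix k assume "k \<in> {..<Suc n}"
    \<comment> \<open>Only quotient rows survive; the remaining columns are renumbered to skip
      \<open>k\<close>.\<close>
    have "mat_delete B n k = mat n n (\<lambda>(i, j). poly (q (if j < k then j else Suc j)) (a i))"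
      by (auto simp: mat_delete_def B_def)
    then show "(\<Prod>j<n. \<Prod>k\<in>{j<..<n}. a j - a k) dvd cofactor B n k"
      unfolding cofactor_def
      using Suc.IH[of "\<lambda>j. q (if j < k then j else Suc j)"] by (simp add: dvd_mult)
  qed
  moreover have "(\<Prod>j<Suc n. \<Prod>k\<in>{j<..<Suc n}. a j - a k) =
      (\<Prod>j<n. a j - a n) * (\<Prod>j<n. \<Prod>k\<in>{j<..<n}. a j - a k)"
  proof -
    have "(\<Prod>k\<in>{j<..<Suc n}. a j - a k) = (a j - a n) * (\<Prod>k\<in>{j<..<n}. a j - a k)"
      if "j < n" for j
    proof -
      have "{j<..<Suc n} = insert n {j<..<n}" using that by auto
      then show ?thesis by simp
    qed
    moreover have "{n<..<Suc n} = {}" by auto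
    ultimately show ?thesis by (simp add: prod.distrib)
  qed
  ultimately show ?case by (simp add: A_def[symmetric] mult_dvd_mono)
qed

lemma vandermonde_dvd_alternant: "vandermonde N dvd alternant N lam"
proof -
  have "vandermonde N = (\<Prod>j<N. \<Prod>k\<in>{Suc j<..N}. Var (Suc j) - Var k)"
    unfolding vandermonde_def
    by (rule prod.reindex_bij_witness[of _ Suc "\<lambda>j. j - 1"]) auto
  also have "\<dots> = (\<Prod>j<N. \<Prod>k\<in>{j<..<N}. Var (Suc j) - Var (Suc k))"
    by (intro prod.cong refl prod.reindex_bij_witness[of _ Suc "\<lambda>j. j - 1"]) auto
  finally have "vandermonde N = \<dots>" .
  moreover have "alternant N lam =
      det (mat N N (\<lambda>(j, k). poly (monom 1 (lam (Suc k) + (N - Suc k))) (Var (Suc j))))"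
    by (simp add: alternant_def poly_monom)
  ultimately show ?thesis
    using det_eval_dvd[of "\<lambda>j. Var (Suc j)" N] by simp
qed

text \<open>Justifies the definite description: divisibility gives existence, cancelling the nonzero
  Vandermonde product gives uniqueness.\<close>

lemma schur_poly_mult_vandermonde: "schur_poly N lam * vandermonde N = alternant N lam"
proof -
  obtain s where s: "alternant N lam = vandermonde N * s"
    using vandermonde_dvd_alternant[of N lam] by (elim dvdE)
  show ?thesis
    unfolding schur_poly_def
  proof (rule theI)
    show "s * vandermonde N = alternant N lam" using s by (simp add: mult.commute)
    show "r = s" if "r * vandermonde N = alternant N lam" for r
      using that s vandermonde_nonzero[of N] by (simp add: mult.commute)
  qed
qed

section \<open>Determinants of lists of rows\<close>

text \<open>The value 0 for a wrong number of rows discards configurations with a wrong number of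
  holes, so sums may run over all of \<open>configs m\<close>.\<close>

definition det_rows :: "nat \<Rightarrow> (nat \<Rightarrow> 'a) list \<Rightarrow> 'a :: comm_ring_1" where
  "det_rows N L = (if length L = N then det (mat N N (\<lambda>(i, j). (L ! i) j)) else 0)"

lemma det_rows_cong:
  assumes "length K = length L" "\<And>i j. i < length L \<Longrightarrow> j < N \<Longrightarrow> (K ! i) j = (L ! i) j"
  shows "det_rows N K = det_rows N L"
  unfolding det_rows_def using assms
  by (auto intro!: arg_cong[of _ _ det])

text \<open>The cofactors along a row do not depend on that row.\<close>

lemma det_rows_linear:
  "det_rows N (A @ (\<lambda>j. a * p j + b * q j) # B) =
    a * det_rows N (A @ p # B) + b * det_rows N (A @ q # B)"
proof (cases "Suc (length A + length B) = N")
  case True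
  let ?k = "length A"
  define X where "X r = mat N N (\<lambda>(i, j). ((A @ r # B) ! i) j)" for r
  have X: "X r \<in> carrier_mat N N" and k: "?k < N" for r
    using True by (auto simp: X_def)
  have "mat_delete (X r) ?k j = mat_delete (X s) ?k j" for r s j
    using True by (auto simp: mat_delete_def X_def nth_append nth_Cons' intro!: cong_mat)
  then have cof: "cofactor (X r) ?k j = cofactor (X (\<lambda>_. 0)) ?k j" for r j
    unfolding cofactor_def by metis
  have "det (X r) = (\<Sum>j<N. r j * cofactor (X (\<lambda>_. 0)) ?k j)" for r
    unfolding laplace_expansion_row[OF X k] cof[of r]
    using k by (intro sum.cong) (auto simp: X_def nth_append)
  then show ?thesis
    using True
    by (simp add: det_rows_def X_def[symmetric] sum.distrib sum_distrib_left algebra_simps)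
next
  case False
  then show ?thesis by (simp add: det_rows_def)
qed

lemma det_rows_repeat: "det_rows N (A @ p # p # B) = 0"
proof (cases "Suc (Suc (length A + length B)) = N")
  case True
  let ?X = "mat N N (\<lambda>(i, j). ((A @ p # p # B) ! i) j)"
  have "det ?X = 0"
    by (rule det_identical_rows[of _ N "length A" "Suc (length A)"])
      (use True in \<open>auto simp: nth_append row_def\<close>)
  then show ?thesis by (simp add: det_rows_def)
next
  case False
  then show ?thesis by (simp add: det_rows_def)
qed

text \<open>In the Leibniz formula every permutation picks up each column factor exactly
  once.\<close>

lemma det_rows_scale:
  "det_rows N (map (\<lambda>p j. f j * p j) L) = (\<Prod>j<N. f j) * det_rows N L"
proof (cases "length L = N")
  case True
  have "(\<Prod>i = 0..<N. f (p i) * (L ! i) (p i)) = (\<Prod>j<N. f j) * (\<Prod>i = 0..<N. (L ! i) (p i))"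
    if "p permutes {0..<N}" for p
    using prod.permute[OF that, of f] by (simp add: prod.distrib lessThan_atLeast0 comp_def)
  moreover have "p i < N" if "p permutes {0..<N}" "i < N" for p i
    using permutes_in_image[OF that(1), of i] that(2) by simp
  ultimately show ?thesis
    using True
    by (simp add: det_rows_def det_def'[of _ N] sum_distrib_left mult.left_commute)
next
  case False
  then show ?thesis by (simp add: det_rows_def)
qed

lemma det_rows_last_column:
  assumes "\<And>q. q \<in> set L \<Longrightarrow> q N = 0"
  shows "det_rows (Suc N) (L @ [p]) = p N * det_rows N L"
proof (cases "length L = N")
  case True
  define X where "X = mat (Suc N) (Suc N) (\<lambda>(i, j). ((L @ [p]) ! i) j)"
  have X: "X \<in> carrier_mat (Suc N) (Suc N)" by (simp add: X_def)
  have "X $$ (i, N) = 0" if "i < N" for i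
    using that True assms by (simp add: X_def nth_append)
  then have "det X = X $$ (N, N) * cofactor X N N"
    unfolding laplace_expansion_column[OF X lessI] by simp
  moreover have "mat_delete X N N = mat N N (\<lambda>(i, j). (L ! i) j)"
    using True by (auto simp: mat_delete_def X_def nth_append intro!: cong_mat)
  ultimately show ?thesis
    using True by (simp add: det_rows_def cofactor_def X_def[symmetric]) (simp add: X_def nth_append)
next
  case False
  then show ?thesis by (simp add: det_rows_def)
qed

lemma det_rows_last_column_zero:
  assumes "\<And>q. q \<in> set L \<Longrightarrow> q N = 0"
  shows "det_rows (Suc N) L = 0"
proof (cases L rule: rev_cases)
  case Nil
  then show ?thesis by (simp add: det_rows_def)
next
  case (snoc K q)
  then have "\<And>p. p \<in> set K \<Longrightarrow> p N = 0" "q N = 0" using assms by auto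
  then show ?thesis by (simp add: snoc det_rows_last_column)
qed

section \<open>The action of the B-operator\<close>

text \<open>The decreasing order matches the decreasing exponents in the columns of the
  alternant.\<close>

primrec holes :: "config \<Rightarrow> nat \<Rightarrow> nat list" where
  "holes n 0 = []"
| "holes n (Suc m) = (if n (Suc m) = 0 then [Suc m] else []) @ holes n m"

text \<open>
  The coefficient of \<open>|\<gamma>\<rangle> \<otimes> |k\<rangle>\<close> in \<open>L\<^sub>a\<^sub>m \<cdots> L\<^sub>a\<^sub>1 |1\<rangle> \<otimes> |n\<rangle>\<close>, provided that \<open>k\<close> and \<open>n\<close> agree
  beyond the site \<open>m\<close>.
\<close>

primrec amplitude :: "complex \<Rightarrow> complex \<Rightarrow> config \<Rightarrow> nat \<Rightarrow> nat \<Rightarrow> config \<Rightarrow> complex" where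
  "amplitude w t n 0 \<gamma> k = (if \<gamma> = 1 then 1 else 0)"
| "amplitude w t n (Suc m) \<gamma> k =
    (\<Sum>\<alpha>\<in>{0, 1}. L_elem w t \<alpha> (n (Suc m)) \<gamma> (k (Suc m)) * amplitude w t n m \<alpha> k)"

lemma length_holes_le: "length (holes n m) \<le> m"
  by (induction m) auto

lemma holes_cong: "(\<And>i. i \<in> {1..m} \<Longrightarrow> k i = l i) \<Longrightarrow> holes k m = holes l m"
  by (induction m) auto

lemma amplitude_cong:
  "(\<And>i. i \<in> {1..m} \<Longrightarrow> k i = l i) \<Longrightarrow> amplitude w t n m \<gamma> k = amplitude w t n m \<gamma> l"
  by (induction m arbitrary: \<gamma>) auto

lemma amplitude_eq_0:
  "i \<in> {1..m} \<Longrightarrow> k i \<notin> {0, 1} \<Longrightarrow> amplitude w t n m \<gamma> k = 0"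
proof (induction m arbitrary: \<gamma>)
  case (Suc m)
  then show ?case
    by (cases "i = Suc m") (auto simp: L_elem_def)
qed simp

lemma finite_configs [simp]: "finite (configs M)"
  by (simp add: configs_def finite_PiE)

lemma sum_configs_Suc:
  "(\<Sum>k\<in>configs (Suc m). f k) =
    (\<Sum>k\<in>configs m. f (k(Suc m := 0))) + (\<Sum>k\<in>configs m. f (k(Suc m := 1)))"
proof -
  let ?g = "\<lambda>(y, k). k(Suc m := y)"
  have *: "{1..Suc m} = insert (Suc m) {1..m}" by auto
  have "configs (Suc m) = ?g ` ({0, 1} \<times> configs m)"
    unfolding configs_def * PiE_insert_eq by simp
  moreover have "inj_on ?g ({0, 1} \<times> configs m)"
    unfolding configs_def by (rule inj_combinator) simp
  ultimately have "(\<Sum>k\<in>configs (Suc m). f k) = (\<Sum>(y, k)\<in>{0, 1} \<times> configs m. f (k(Suc m := y)))"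
    by (simp add: sum.reindex case_prod_unfold comp_def)
  then show ?thesis
    by (simp add: sum.cartesian_product[symmetric])
qed

section \<open>Matrix elements of the monodromy and of the B-operator\<close>

lemma monodromy_Suc: "monodromy (Suc m) w t \<Psi> = L_op (Suc m) w t (monodromy m w t \<Psi>)"
  by (simp add: monodromy_def)

lemma monodromy_ket:
  assumes "\<And>i. i \<in> {1..m} \<Longrightarrow> n i \<in> {0, 1}"
  shows "monodromy m w t (aux_ket 1 (ket n)) \<gamma> k =
    (if \<forall>i. i \<notin> {1..m} \<longrightarrow> k i = n i then amplitude w t n m \<gamma> k else 0)"
  using assms
proof (induction m arbitrary: \<gamma> k)
  case 0
  show ?case by (auto simp: monodromy_def aux_ket_def ket_def)
next
  case (Suc m)
  let ?c = "\<forall>i. i \<notin> {1..Suc m} \<longrightarrow> k i = n i"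
  have n: "n (Suc m) \<in> {0, 1}" using Suc.prems by simp
  have amp: "amplitude w t n m \<alpha> (k(Suc m := \<beta>)) = amplitude w t n m \<alpha> k" for \<alpha> \<beta>
    by (rule amplitude_cong) auto
  \<comment> \<open>Site \<open>m + 1\<close> still carries its input value, so only
    \<open>\<beta> = n (Suc m)\<close> survives in the sum of \<open>L_op\<close>.\<close>
  have IH: "monodromy m w t (aux_ket 1 (ket n)) \<alpha> (k(Suc m := \<beta>)) =
      (if \<beta> = n (Suc m) \<and> ?c then amplitude w t n m \<alpha> k else 0)" for \<alpha> \<beta>
  proof -
    have "monodromy m w t (aux_ket 1 (ket n)) \<alpha> (k(Suc m := \<beta>)) =
        (if \<forall>i. i \<notin> {1..m} \<longrightarrow> (k(Suc m := \<beta>)) i = n i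
         then amplitude w t n m \<alpha> (k(Suc m := \<beta>)) else 0)"
      by (rule Suc.IH) (use Suc.prems in auto)
    moreover have "(\<forall>i. i \<notin> {1..m} \<longrightarrow> (k(Suc m := \<beta>)) i = n i) \<longleftrightarrow> \<beta> = n (Suc m) \<and> ?c"
      by (auto simp: le_Suc_eq split: if_splits)
    ultimately show ?thesis by (simp only: amp)
  qed
  show ?case
    unfolding monodromy_Suc L_op_def IH using n by auto
qed

lemma B_op_ket:
  assumes n: "n \<in> configs M"
  shows "B_op M w t (ket n) = (\<lambda>l. \<Sum>k\<in>configs M. amplitude w t n M 0 k * ket k l)"
proof
  fix l
  have n01: "n i \<in> {0, 1}" if "i \<in> {1..M}" for i
    using n that by (auto simp: configs_def)
  have B: "B_op M w t (ket n) l =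
      (if \<forall>i. i \<notin> {1..M} \<longrightarrow> l i = n i then amplitude w t n M 0 l else 0)"
    unfolding B_op_def aux_bra_def by (rule monodromy_ket) (rule n01)
  have R: "(\<Sum>k\<in>configs M. amplitude w t n M 0 k * ket k l) =
      (if l \<in> configs M then amplitude w t n M 0 l else 0)"
    by (simp add: ket_def if_distrib[of "\<lambda>x. _ * x"] cong: if_cong)
  show "B_op M w t (ket n) l = (\<Sum>k\<in>configs M. amplitude w t n M 0 k * ket k l)"
  proof (cases "l \<in> configs M")
    case True
    then have "\<forall>i. i \<notin> {1..M} \<longrightarrow> l i = n i"
      using n unfolding configs_def by (metis PiE_arb)
    then show ?thesis unfolding B R using True by simp
  next
    case False
    \<comment> \<open>Such an \<open>l\<close> takes a value other than 0 and 1 at some site, and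
      there every weight of the \<open>L\<close>-operator vanishes.\<close>
    have "amplitude w t n M 0 l = 0" if c: "\<forall>i. i \<notin> {1..M} \<longrightarrow> l i = n i"
    proof -
      have "\<exists>i\<in>{1..M}. l i \<notin> {0, 1}"
      proof (rule ccontr)
        assume "\<not> ?thesis"
        moreover have "l i = undefined" if "i \<notin> {1..M}" for i
          using n c that unfolding configs_def by (metis PiE_arb)
        ultimately show False
          using False unfolding configs_def by (auto intro!: PiE_I)
      qed
      then show ?thesis using amplitude_eq_0 by blast
    qed
    then show ?thesis unfolding B R using False by simp
  qed
qed

lemma monodromy_sum:
  "monodromy m w t (\<lambda>\<gamma> n. \<Sum>k\<in>A. c k * G k \<gamma> n) = (\<lambda>\<gamma> n. \<Sum>k\<in>A. c k * monodromy m w t (G k) \<gamma> n)"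
proof (induction m)
  case 0
  show ?case by (simp add: monodromy_def)
next
  case (Suc m)
  show ?case
    unfolding monodromy_Suc Suc L_op_def
    by (simp add: sum.distrib[symmetric] sum_distrib_left algebra_simps)
qed

lemma B_op_sum:
  "B_op M w t (\<lambda>n. \<Sum>k\<in>A. c k * g k n) = (\<lambda>n. \<Sum>k\<in>A. c k * B_op M w t (g k) n)"
proof -
  have "aux_ket 1 (\<lambda>n. \<Sum>k\<in>A. c k * g k n) = (\<lambda>\<gamma> n. \<Sum>k\<in>A. c k * aux_ket 1 (g k) \<gamma> n)"
    by (auto simp: aux_ket_def fun_eq_iff)
  then show ?thesis
    by (simp add: B_op_def aux_bra_def monodromy_sum)
qed

definition dual_coordinate :: "nat \<Rightarrow> nat \<Rightarrow> complex \<Rightarrow> (nat \<Rightarrow> complex) \<Rightarrow> config \<Rightarrow> complex" where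
  "dual_coordinate M N t z n =
    bra (all_particles M) (foldr (\<lambda>j. B_op M (z j) t) [1..<Suc N] (ket n))"

lemma foldr_B_op_sum:
  "foldr (\<lambda>j. B_op M (z j) t) js (\<lambda>n. \<Sum>k\<in>A. c k * g k n) =
    (\<lambda>n. \<Sum>k\<in>A. c k * foldr (\<lambda>j. B_op M (z j) t) js (g k) n)"
  by (induction js) (simp_all add: B_op_sum)

lemma dual_coordinate_0: "dual_coordinate M 0 t z n = (if n = all_particles M then 1 else 0)"
  by (auto simp: dual_coordinate_def bra_def ket_def)

text \<open>\<open>foldr\<close> applies the operator with the last variable to the ket first, so
  this operator is the one stripped off.\<close>

lemma dual_coordinate_Suc:
  assumes "n \<in> configs M"
  shows "dual_coordinate M (Suc N) t z n =
    (\<Sum>k\<in>configs M. amplitude (z (Suc N)) t n M 0 k * dual_coordinate M N t z k)"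
  using assms by (simp add: dual_coordinate_def B_op_ket foldr_B_op_sum bra_def)

section \<open>The determinant recursion\<close>

text \<open>
  The rows indexed by \<open>R\<close> are sites beyond \<open>m\<close> that have already been chosen as holes of the output;
  the recursion in \<open>m\<close> moves the site \<open>m + 1\<close> into \<open>R\<close>.
\<close>

definition transfer_sum ::
  "nat \<Rightarrow> (nat \<Rightarrow> complex) \<Rightarrow> complex \<Rightarrow> complex \<Rightarrow> config \<Rightarrow> nat \<Rightarrow> nat list \<Rightarrow> nat \<Rightarrow> complex" where
  "transfer_sum N u w t n \<gamma> R m =
    (\<Sum>k\<in>configs m. amplitude w t n m \<gamma> k *
      det_rows N (map (\<lambda>y j. u j ^ (y - 1)) (R @ holes k m)))"

lemma transfer_sum_0:
  "transfer_sum N u w t n \<gamma> R 0 = (if \<gamma> = 1 then det_rows N (map (\<lambda>y j. u j ^ (y - 1)) R) else 0)"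
  by (simp add: transfer_sum_def configs_def)

lemma transfer_sum_Suc:
  "transfer_sum N u w t n \<gamma> R (Suc m) =
    (\<Sum>\<alpha>\<in>{0, 1}. L_elem w t \<alpha> (n (Suc m)) \<gamma> 0 * transfer_sum N u w t n \<alpha> (R @ [Suc m]) m) +
    (\<Sum>\<alpha>\<in>{0, 1}. L_elem w t \<alpha> (n (Suc m)) \<gamma> 1 * transfer_sum N u w t n \<alpha> R m)"
proof -
  have a: "amplitude w t n m \<alpha> (k(Suc m := \<beta>)) = amplitude w t n m \<alpha> k" for k \<alpha> \<beta>
    by (rule amplitude_cong) auto
  have h: "holes (k(Suc m := \<beta>)) m = holes k m" for k \<beta>
    by (rule holes_cong) auto
  show ?thesis
    unfolding transfer_sum_def sum_configs_Suc
    by (simp add: a h sum_distrib_left sum.distrib algebra_simps)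
qed

text \<open>
  Extended rows are the rows \<open>u\<^sub>j\<^sup>y\<^sup>-\<^sup>1\<close> with the new variable \<open>v\<close> in the last column; reduced rows
  stand for output holes and do not involve \<open>v\<close>. The column factors \<open>u\<^sub>j + t v\<close> and \<open>u\<^sub>j - v\<close> clear
  the denominators of the ratio between the two determinants, so that both kinds of rows are
  tied by the linear relation \<open>c\<^sub>y\<^sub>+\<^sub>1 - e\<^sub>y\<^sub>+\<^sub>1 = v c\<^sub>y + t v e\<^sub>y\<close>.
\<close>

definition extended_row :: "nat \<Rightarrow> (nat \<Rightarrow> complex) \<Rightarrow> complex \<Rightarrow> complex \<Rightarrow> nat \<Rightarrow> nat \<Rightarrow> complex" where
  "extended_row N u v t y = (\<lambda>j. if j < N then (u j + t * v) * u j ^ (y - 1) else v ^ (y - 1))"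

definition reduced_row :: "nat \<Rightarrow> (nat \<Rightarrow> complex) \<Rightarrow> complex \<Rightarrow> nat \<Rightarrow> nat \<Rightarrow> complex" where
  "reduced_row N u v y = (\<lambda>j. if j < N then (u j - v) * u j ^ (y - 1) else 0)"

text \<open>Both auxiliary indices are handled together and for arbitrary \<open>R\<close>, since
  one site mixes the indices and may extend \<open>R\<close>. The exponent of \<open>t\<close>
  counts the particles of \<open>n\<close> up to site \<open>m\<close>. For index 1 there is one
  more row, \<open>c (Suc m) - e (Suc m)\<close>: a hole of \<open>n\<close> at the next site
  completes it to \<open>c (Suc m)\<close>, a particle shifts it by one site through the linear
  relation between the rows.\<close>

lemma transfer_sum_eq:
  fixes N :: nat and u :: "nat \<Rightarrow> complex" and v t :: complex
  assumes "\<And>i. i \<in> {1..m} \<Longrightarrow> n i \<in> {0, 1}"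
  defines "c \<equiv> extended_row N u v t" and "e \<equiv> reduced_row N u v"
    and "S \<equiv> transfer_sum N u (t * v) t n"
  shows "(\<Prod>j<N. u j - v) * S 0 R m =
      t ^ (m - length (holes n m)) * det_rows (Suc N) (map e R @ map c (holes n m))"
    and "(\<Prod>j<N. u j - v) * S 1 R m =
      t ^ (m - length (holes n m)) *
      det_rows (Suc N) (map e R @ (\<lambda>j. c (Suc m) j - e (Suc m) j) # map c (holes n m))"
proof -
  define P where "P = (\<Prod>j<N. u j - v)"
  define D where "D = (det_rows (Suc N) :: (nat \<Rightarrow> complex) list \<Rightarrow> complex)"
  define d where "d m = (\<lambda>j. c (Suc m) j - e (Suc m) j)" for m
  have d_Suc: "d (Suc m) = (\<lambda>j. v * c (Suc m) j + t * v * e (Suc m) j)" for m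
    by (auto simp: d_def c_def e_def extended_row_def reduced_row_def algebra_simps)
  have step: "D (A @ d (Suc m) # B) =
      v * D (A @ c (Suc m) # B) + t * v * D (A @ e (Suc m) # B)" for A B m
    unfolding D_def d_Suc by (rule det_rows_linear)
  have split: "D (A @ c (Suc m) # B) = D (A @ d m # B) + D (A @ e (Suc m) # B)" for A B m
    using det_rows_linear[of "Suc N" A 1 "d m" 1 "e (Suc m)" B]
    by (simp add: d_def D_def)
  have repeat: "D (A @ p # p # B) = 0" for A p B
    by (simp add: D_def det_rows_repeat)
  have e_N: "e y N = 0" for y by (simp add: e_def reduced_row_def)
  have "P * S 0 R m = t ^ (m - length (holes n m)) * D (map e R @ map c (holes n m)) \<and>
      P * S 1 R m = t ^ (m - length (holes n m)) * D (map e R @ d m # map c (holes n m))"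
    using assms(1)
  proof (induction m arbitrary: R)
    case 0
    \<comment> \<open>Reduced rows vanish in the last column, which kills the determinant for index
      0. For index 1 the only entry there is \<open>d 0 N = 1\<close>, and expanding along that
      column leaves the reduced rows.\<close>
    have "D (map e R) = 0"
      unfolding D_def by (rule det_rows_last_column_zero) (auto simp: e_N)
    moreover have "P * det_rows N (map (\<lambda>y j. u j ^ (y - 1)) R) = D (map e R @ [d 0])"
    proof -
      have "D (map e R @ [d 0]) = det_rows N (map e R)"
        unfolding D_def by (subst det_rows_last_column)
          (auto simp: e_N d_def c_def extended_row_def)
      also have "\<dots> =
          det_rows N (map (\<lambda>p j. (u j - v) * p j) (map (\<lambda>y j. u j ^ (y - 1)) R))"
        by (rule det_rows_cong) (auto simp: e_def reduced_row_def)
      finally show ?thesis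
        by (simp add: det_rows_scale P_def del: map_map)
    qed
    ultimately show ?case by (simp add: S_def transfer_sum_0)
  next
    case (Suc m)
    define l where "l = length (holes n m)"
    have pw: "t ^ (Suc m - l) = t * t ^ (m - l)"
      using length_holes_le[of n m] by (simp add: l_def Suc_diff_le)
    have IH0: "P * S 0 R m = t ^ (m - l) * D (map e R @ map c (holes n m))"
      and IH1: "P * S 1 R m = t ^ (m - l) * D (map e R @ d m # map c (holes n m))" for R
      using Suc by (simp_all add: l_def)
    consider "n (Suc m) = 1" | "n (Suc m) = 0" using Suc.prems[of "Suc m"] by auto
    then show ?case
    proof cases
      case 1
      have S: "S 0 R (Suc m) = t * S 0 R m"
        "S 1 R (Suc m) = t * v * S 1 R m + (t + 1) * (t * v) * S 0 (R @ [Suc m]) m"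
        using 1 by (simp_all add: S_def transfer_sum_Suc L_elem_def)
      have "P * S 1 R (Suc m) =
          t * v * (P * S 1 R m) + (t + 1) * (t * v) * (P * S 0 (R @ [Suc m]) m)"
        unfolding S(2) by (simp add: algebra_simps)
      \<comment> \<open>With all other rows fixed, this is \<open>t * v * d m + (t + 1) * t * v * e
        (Suc m) = t * (v * c (Suc m) + t * v * e (Suc m)) = t * d (Suc m)\<close>.\<close>
      also have "\<dots> = t ^ (m - l) * (t * D (map e R @ d (Suc m) # map c (holes n m)))"
        using IH0[of "R @ [Suc m]"] unfolding IH1 step split by (simp add: algebra_simps)
      finally show ?thesis
        using 1 IH0[of R] by (simp add: S(1) pw l_def[symmetric] algebra_simps)
    next
      case 2
      have S: "S 0 R (Suc m) = S 0 (R @ [Suc m]) m + S 1 R m"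
        "S 1 R (Suc m) = t * v * S 1 (R @ [Suc m]) m"
        using 2 by (simp_all add: S_def transfer_sum_Suc L_elem_def)
      have "P * S 0 R (Suc m) = t ^ (m - l) * D (map e R @ c (Suc m) # map c (holes n m))"
        using IH0[of "R @ [Suc m]"] unfolding S distrib_left IH1 split
        by (simp add: algebra_simps)
      \<comment> \<open>Both sides reduce to the rows \<open>e (Suc m)\<close>,
        \<open>c (Suc m)\<close> with factor \<open>t * v\<close>: repeated rows \<open>e\<close>,
        \<open>e\<close> drop out on the left and \<open>c\<close>, \<open>c\<close> on the
        right.\<close>
      moreover have "P * S 1 R (Suc m) =
          t ^ (m - l) * D (map e R @ d (Suc m) # c (Suc m) # map c (holes n m))"
        using IH1[of "R @ [Suc m]"]
          split[of "map e R @ [e (Suc m)]"] repeat[of "map e R" "e (Suc m)"]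
        unfolding S(2) by (simp add: step repeat mult.left_commute[of P])
      ultimately show ?thesis using 2 by (simp add: l_def)
    qed
  qed
  then show "P * S 0 R m = t ^ (m - length (holes n m)) * D (map e R @ map c (holes n m))"
    and "P * S 1 R m = t ^ (m - length (holes n m)) * D (map e R @ d m # map c (holes n m))"
    by simp_all
qed

section \<open>Induction on the number of B-operators\<close>

lemma prod_pairs_Suc:
  fixes f :: "nat \<Rightarrow> nat \<Rightarrow> 'a :: comm_monoid_mult"
  shows "(\<Prod>j\<in>{1..Suc N}. \<Prod>k\<in>{j<..Suc N}. f j k) =
    (\<Prod>j\<in>{1..N}. \<Prod>k\<in>{j<..N}. f j k) * (\<Prod>j<N. f (Suc j) (Suc N))"
proof -
  have "(\<Prod>k\<in>{j<..Suc N}. f j k) = (\<Prod>k\<in>{j<..N}. f j k) * f j (Suc N)" if "j \<in> {1..N}" for j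
  proof -
    have "{j<..Suc N} = insert (Suc N) {j<..N}" using that by auto
    then show ?thesis by (simp add: mult.commute)
  qed
  then show ?thesis
    by (simp add: prod.distrib prod.atLeast1_atMost_eq)
qed

lemma set_holes: "set (holes n m) = {i \<in> {1..m}. n i = 0}"
  by (induction m) (auto simp: le_Suc_eq)

lemma holes_eq_Nil_iff:
  assumes "n \<in> configs M"
  shows "holes n M = [] \<longleftrightarrow> n = all_particles M"
proof -
  have "holes n M = [] \<longleftrightarrow> {i \<in> {1..M}. n i = 0} = {}"
    by (simp only: set_holes[symmetric] set_empty)
  also have "\<dots> \<longleftrightarrow> n = all_particles M"
  proof
    assume "{i \<in> {1..M}. n i = 0} = {}"
    then have "n i = 1" if "i \<in> {1..M}" for i
      using assms that PiE_mem[of n "{1..M}" "\<lambda>_. {0, 1}" i] by (auto simp: configs_def)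
    moreover have "n i = undefined" if "i \<notin> {1..M}" for i
      using assms that unfolding configs_def by (rule PiE_arb)
    ultimately show "n = all_particles M"
      unfolding all_particles_def by (auto simp: fun_eq_iff)
  qed (auto simp: all_particles_def)
  finally show ?thesis .
qed

text \<open>Keeping the Vandermonde product on the left avoids division, so coinciding variables are
  allowed here. All \<open>n\<close> are covered because the induction step sums over all output
  configurations.\<close>

lemma dual_coordinate_eq:
  assumes "t \<noteq> 0" "N \<le> M" "n \<in> configs M"
  shows "(\<Prod>j\<in>{1..N}. \<Prod>k\<in>{j<..N}. z j / t - z k / t) * dual_coordinate M N t z n =
    t ^ (N * (M - N)) * (\<Prod>j\<in>{1..N}. \<Prod>k\<in>{j<..N}. z j + t * z k) *
    det_rows N (map (\<lambda>y j. (z (Suc j) / t) ^ (y - 1)) (holes n M))"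
  using assms(2,3)
proof (induction N arbitrary: n)
  case 0
  have "det (mat 0 0 f) = (1 :: complex)" for f by (rule det_dim_zero) simp
  then show ?case
    using holes_eq_Nil_iff[OF 0(2)] by (simp add: dual_coordinate_0 det_rows_def)
next
  case (Suc N)
  define V where "V = (\<Prod>j\<in>{1..N}. \<Prod>k\<in>{j<..N}. z j / t - z k / t)"
  define Q where "Q = (\<Prod>j\<in>{1..N}. \<Prod>k\<in>{j<..N}. z j + t * z k)"
  define u where "u j = z (Suc j) / t" for j
  define v where "v = u N"
  define l where "l = length (holes n M)"
  have z: "z (Suc N) = t * v" and zu: "z (Suc j) = t * u j" for j
    using assms(1) by (simp_all add: u_def v_def)
  have IH: "V * dual_coordinate M N t z k =
      t ^ (N * (M - N)) * Q * det_rows N (map (\<lambda>y j. u j ^ (y - 1)) (holes k M))"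
    if "k \<in> configs M" for k
    unfolding V_def Q_def u_def by (rule Suc.IH) (use Suc.prems that in auto)
  have "V * dual_coordinate M (Suc N) t z n =
      (\<Sum>k\<in>configs M. amplitude (t * v) t n M 0 k * (V * dual_coordinate M N t z k))"
    by (simp add: dual_coordinate_Suc[OF Suc.prems(2)] z sum_distrib_left mult.left_commute)
  also have "\<dots> = t ^ (N * (M - N)) * Q * transfer_sum N u (t * v) t n 0 [] M"
    by (simp add: IH transfer_sum_def sum_distrib_left mult.left_commute)
  finally have "(\<Prod>j<N. u j - v) * (V * dual_coordinate M (Suc N) t z n) =
      t ^ (N * (M - N)) * Q * ((\<Prod>j<N. u j - v) * transfer_sum N u (t * v) t n 0 [] M)"
    by (simp add: ac_simps)
  also have "(\<Prod>j<N. u j - v) * transfer_sum N u (t * v) t n 0 [] M =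
      t ^ (M - l) * det_rows (Suc N) (map (extended_row N u v t) (holes n M))"
    using Suc.prems(2) by (subst transfer_sum_eq(1)) (auto simp: configs_def l_def)
  \<comment> \<open>Since \<open>v = u N\<close>, the last column already has the required form; the
    other columns carry the factor \<open>u j + t * v\<close>.\<close>
  also have "det_rows (Suc N) (map (extended_row N u v t) (holes n M)) =
      det_rows (Suc N) (map (\<lambda>p j. (if j < N then u j + t * v else 1) * p j)
        (map (\<lambda>y j. u j ^ (y - 1)) (holes n M)))"
    by (rule det_rows_cong) (auto simp: extended_row_def u_def v_def less_Suc_eq)
  also have "\<dots> = (\<Prod>j<N. u j + t * v) *
      det_rows (Suc N) (map (\<lambda>y j. u j ^ (y - 1)) (holes n M))"
    unfolding det_rows_scale by simp
  finally have *: "(\<Prod>j<N. u j - v) * (V * dual_coordinate M (Suc N) t z n) =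
      t ^ (N * (M - N)) * Q * (t ^ (M - l) * ((\<Prod>j<N. u j + t * v) *
        det_rows (Suc N) (map (\<lambda>y j. u j ^ (y - 1)) (holes n M))))" .
  have pairs: "(\<Prod>j\<in>{1..Suc N}. \<Prod>k\<in>{j<..Suc N}. z j + t * z k) =
      Q * (t ^ N * (\<Prod>j<N. u j + t * v))"
  proof -
    have "z (Suc j) + t * z (Suc N) = t * (u j + t * v)" for j
      by (simp add: zu v_def algebra_simps)
    then show ?thesis
      unfolding prod_pairs_Suc Q_def by (simp add: prod.distrib)
  qed
  \<comment> \<open>The surplus \<open>t ^ N\<close> is absorbed by \<open>pairs\<close>. The
    exponents only have to agree for \<open>l = Suc N\<close>, as the determinant vanishes
    otherwise.\<close>
  have "t ^ (N * (M - N)) * t ^ (M - l) = t ^ (Suc N * (M - Suc N)) * t ^ N" if "l = Suc N"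
  proof -
    obtain d where "M = Suc N + d" using Suc.prems(1) le_Suc_ex by blast
    then have "N * (M - N) + (M - l) = Suc N * (M - Suc N) + N"
      using that by simp
    then show ?thesis by (simp only: power_add[symmetric])
  qed
  moreover have "det_rows (Suc N) (map (\<lambda>y j. u j ^ (y - 1)) (holes n M)) = 0" if "l \<noteq> Suc N"
    using that by (simp add: det_rows_def l_def)
  ultimately have **: "t ^ (N * (M - N)) * t ^ (M - l) *
      det_rows (Suc N) (map (\<lambda>y j. u j ^ (y - 1)) (holes n M)) =
    t ^ (Suc N * (M - Suc N)) * t ^ N *
      det_rows (Suc N) (map (\<lambda>y j. u j ^ (y - 1)) (holes n M))"
    by (metis mult_zero_right)
  have rearrange: "V * a * X = T * (Q * (T' * P)) * D"
    if "a * (V * X) = q * Q * (q' * (P * D))" "q * q' * D = T * T' * D"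
    for V a X T T' Q P D q q' :: complex
  proof -
    have "V * a * X = q * q' * D * (Q * P)" using that(1) by (simp add: ac_simps)
    then show ?thesis unfolding that(2) by (simp add: ac_simps)
  qed
  show ?case
    unfolding pairs prod_pairs_Suc[of "\<lambda>j k. z j / t - z k / t"] V_def[symmetric]
      u_def[symmetric] v_def[symmetric]
    by (rule rearrange[OF * **])
qed

section \<open>From hole configurations to Young diagrams\<close>

lemma sorted_holes: "sorted_wrt (>) (holes n m)"
  by (induction m) (auto simp: set_holes)

lemma holes_hole_config:
  assumes "x ` {1..N} \<subseteq> {1..M}" "strict_mono_on {1..N} x"
  shows "holes (hole_config M (x ` {1..N})) M = rev (map x [1..<Suc N])"
proof -
  have "sorted_wrt (<) (rev (holes (hole_config M (x ` {1..N})) M))"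
    using sorted_holes by (simp add: sorted_wrt_rev)
  moreover have "sorted_wrt (<) (map x [1..<Suc N])"
    unfolding sorted_wrt_map
    by (rule sorted_wrt_mono_rel[OF _ sorted_wrt_upt]) (use assms(2) in \<open>auto simp: strict_mono_on_def\<close>)
  moreover have "set (rev (holes (hole_config M (x ` {1..N})) M)) = set (map x [1..<Suc N])"
  proof -
    have "{1..<Suc N} = {1..N}" by auto
    then show ?thesis
      using assms(1) by (auto simp: set_holes hole_config_def)
  qed
  ultimately have "rev (holes (hole_config M (x ` {1..N})) M) = map x [1..<Suc N]"
    by (rule strict_sorted_equal[OF _ _ sym, THEN sym])
  then show ?thesis by (metis rev_rev_ident)
qed

lemma strict_mono_on_ge_index:
  fixes x :: "nat \<Rightarrow> nat"
  assumes "strict_mono_on {1..N} x" "0 < x 1" "1 \<le> i" "i \<le> N"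
  shows "i \<le> x i"
  using assms(3,4)
proof (induction i rule: dec_induct)
  case base
  then show ?case using assms(2) by simp
next
  case (step i)
  then have "x i < x (Suc i)"
    by (intro strict_mono_onD[OF assms(1)]) auto
  then show ?case using step by simp
qed

text \<open>The shift by \<open>N - Suc k\<close> turns the parts of the partition back into
  \<open>x (N - k) - 1\<close>. A transposition is needed because variables index the rows of the
  alternant but the columns of \<open>det_rows\<close>.\<close>

lemma eval_mpoly_alternant_hole_partition:
  assumes "x ` {1..N} \<subseteq> {1..M}" "strict_mono_on {1..N} x"
  shows "eval_mpoly u (alternant N (hole_partition N x)) =
    det_rows N (map (\<lambda>y j. u (Suc j) ^ (y - 1)) (holes (hole_config M (x ` {1..N})) M))"
proof -
  let ?A = "mat N N (\<lambda>(j, k). u (Suc j) ^ (hole_partition N x (Suc k) + (N - Suc k)))"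
  let ?L = "map (\<lambda>y j. u (Suc j) ^ (y - 1)) (rev (map x [1..<Suc N]))"
  have ge: "N - k \<le> x (N - k)" if "k < N" for k
  proof (rule strict_mono_on_ge_index[OF assms(2)])
    have "x 1 \<in> {1..M}" using that by (intro subsetD[OF assms(1)] imageI) simp
    then show "0 < x 1" by simp
  qed (use that in auto)
  have "hole_partition N x (Suc k) + (N - Suc k) = x (N - k) - 1" if "k < N" for k
    using ge[OF that] that by (simp add: hole_partition_def Suc_diff_Suc)
  moreover have "(?L ! k) j = u (Suc j) ^ (x (N - k) - 1)" if "k < N" for j k
    using that by (simp add: rev_nth Suc_diff_Suc del: upt_Suc)
  ultimately have "?A\<^sup>T = mat N N (\<lambda>(i, j). (?L ! i) j)"
    by (intro eq_matI) (simp_all del: upt_Suc)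
  moreover have "det (?A\<^sup>T) = det ?A" by (rule det_transpose[of _ N]) simp
  moreover have "length ?L = N" by simp
  ultimately show ?thesis
    unfolding eval_mpoly_alternant det_rows_def holes_hole_config[OF assms] by (simp del: upt_Suc)
qed

lemma hole_config_in_configs: "hole_config M X \<in> configs M"
  by (auto simp: hole_config_def configs_def)

lemma dual_wavefunction_eq:
  "dual_wavefunction M N t z x = dual_coordinate M N t z (hole_config M (x ` {1..N}))"
  by (simp add: dual_wavefunction_def dual_coordinate_def)

section \<open>Coinciding variables\<close>

lemma continuous_on_amplitude:
  assumes "continuous_on S w"
  shows "continuous_on S (\<lambda>s. amplitude (w s) t n m \<gamma> k)"
proof (induction m arbitrary: \<gamma>)
  case (Suc m)
  \<comment> \<open>Every weight is affine in the spectral parameter, which spares a case analysis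
    on the indices.\<close>
  have affine: "L_elem w t \<alpha> \<beta> \<gamma> \<delta> =
      L_elem 0 t \<alpha> \<beta> \<gamma> \<delta> + w * (L_elem 1 t \<alpha> \<beta> \<gamma> \<delta> - L_elem 0 t \<alpha> \<beta> \<gamma> \<delta>)"
    for w \<alpha> \<beta> \<gamma> \<delta>
    by (simp add: L_elem_def)
  have "continuous_on S (\<lambda>s. L_elem (w s) t \<alpha> \<beta> \<gamma> \<delta>)" for \<alpha> \<beta> \<gamma> \<delta>
    by (subst affine) (intro continuous_intros assms)
  with Suc show ?case
    by (auto intro!: continuous_intros)
qed simp

lemma continuous_on_dual_coordinate:
  assumes "\<And>j. continuous_on S (\<lambda>s. z s j)" "n \<in> configs M"
  shows "continuous_on S (\<lambda>s. dual_coordinate M N t (z s) n)"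
  using assms(2)
proof (induction N arbitrary: n)
  case (Suc N)
  have "continuous_on S (\<lambda>s. \<Sum>k\<in>configs M.
      amplitude (z s (Suc N)) t n M 0 k * dual_coordinate M N t (z s) k)"
    by (rule continuous_on_sum, rule continuous_on_mult)
      (simp_all add: continuous_on_amplitude assms(1) Suc.IH)
  then show ?case
    using Suc.prems by (simp only: dual_coordinate_Suc)
qed (simp add: dual_coordinate_0)

lemma dual_wavefunction_distinct:
  assumes "N \<le> M" "t \<noteq> 0" "x ` {1..N} \<subseteq> {1..M}" "strict_mono_on {1..N} x" "inj_on z {1..N}"
  shows "dual_wavefunction M N t z x =
    t ^ (N * (M - N)) * (\<Prod>j\<in>{1..N}. \<Prod>k\<in>{j<..N}. z j + t * z k)
      * eval_mpoly (\<lambda>j. z j / t) (schur_poly N (hole_partition N x))"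
proof -
  define V where "V = eval_mpoly (\<lambda>j. z j / t) (vandermonde N)"
  have "V * dual_wavefunction M N t z x =
      t ^ (N * (M - N)) * (\<Prod>j\<in>{1..N}. \<Prod>k\<in>{j<..N}. z j + t * z k) *
      eval_mpoly (\<lambda>j. z j / t) (alternant N (hole_partition N x))"
    unfolding dual_wavefunction_eq V_def eval_mpoly_vandermonde
      dual_coordinate_eq[OF assms(2,1) hole_config_in_configs]
      eval_mpoly_alternant_hole_partition[OF assms(3,4)] ..
  also have "eval_mpoly (\<lambda>j. z j / t) (alternant N (hole_partition N x)) =
      eval_mpoly (\<lambda>j. z j / t) (schur_poly N (hole_partition N x)) * V"
    unfolding V_def eval_mpoly_mult[symmetric] schur_poly_mult_vandermonde ..
  finally have "V * dual_wavefunction M N t z x = V * (t ^ (N * (M - N)) *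
      (\<Prod>j\<in>{1..N}. \<Prod>k\<in>{j<..N}. z j + t * z k) *
      eval_mpoly (\<lambda>j. z j / t) (schur_poly N (hole_partition N x)))"
    by (simp add: ac_simps)
  moreover have "V \<noteq> 0"
    using assms(2,5) by (auto simp: V_def eval_mpoly_vandermonde dest!: inj_onD)
  ultimately show ?thesis by simp
qed

lemma eventually_inj_on_perturb:
  fixes z :: "nat \<Rightarrow> complex"
  shows "\<forall>\<^sub>F s in at 0. inj_on (\<lambda>j. z j + s * of_nat j) {1..N}"
proof -
  define F where "F = (\<lambda>(j, k). (z j - z k) / (of_nat k - of_nat j)) ` ({1..N} \<times> {1..N})"
  have "finite F" by (simp add: F_def)
  \<comment> \<open>Pairs with \<open>j = k\<close> put 0 into \<open>F\<close>. It is removed to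
    obtain an open neighbourhood of 0; the filter \<open>at 0\<close> ignores the point
    itself.\<close>
  then have "\<forall>\<^sub>F s in at 0. s \<notin> F"
    unfolding eventually_at_topological
    by (intro exI[of _ "- (F - {0})"] conjI open_Compl finite_imp_closed) auto
  then show ?thesis
  proof (rule eventually_mono)
    fix s
    assume s: "s \<notin> F"
    show "inj_on (\<lambda>j. z j + s * of_nat j) {1..N}"
    proof (rule inj_onI, rule ccontr)
      fix j k
      assume jk: "j \<in> {1..N}" "k \<in> {1..N}" "z j + s * of_nat j = z k + s * of_nat k" "j \<noteq> k"
      then have "s = (z j - z k) / (of_nat k - of_nat j)"
        by (simp add: field_simps)
      then have "s \<in> F"
        unfolding F_def using jk(1,2) by (intro image_eqI[of _ _ "(j, k)"]) auto
      then show False using s by blast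
    qed
  qed
qed

theorem theorem4p1:
  fixes M N :: nat and z :: "nat \<Rightarrow> complex" and t :: complex and x :: "nat \<Rightarrow> nat"
  assumes "1 \<le> N" and "N \<le> M"
    and "t \<noteq> 0"
    and "x ` {1..N} \<subseteq> {1..M}" and "strict_mono_on {1..N} x"
  shows "dual_wavefunction M N t z x =
    t ^ (N * (M - N)) * (\<Prod>j\<in>{1..N}. \<Prod>k\<in>{j<..N}. z j + t * z k)
      * eval_mpoly (\<lambda>j. z j / t) (schur_poly N (hole_partition N x))"
proof -
  define f where "f z = dual_wavefunction M N t z x" for z
  define g where "g z = t ^ (N * (M - N)) * (\<Prod>j\<in>{1..N}. \<Prod>k\<in>{j<..N}. z j + t * z k)
      * eval_mpoly (\<lambda>j. z j / t) (schur_poly N (hole_partition N x))" for z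
  \<comment> \<open>This line through \<open>z = y 0\<close> has distinct coordinates at all small
    \<open>s \<noteq> 0\<close>, so both sides of the claim agree there and have the same limit at
    0.\<close>
  define y where "y = (\<lambda>s :: complex. \<lambda>j. z j + s * of_nat j)"
  have y: "continuous_on UNIV (\<lambda>s. y s j)" for j
    unfolding y_def by (intro continuous_intros)
  have "continuous_on UNIV (\<lambda>s. f (y s))"
    unfolding f_def dual_wavefunction_eq
    by (intro continuous_on_dual_coordinate y hole_config_in_configs)
  then have f: "((\<lambda>s. f (y s)) \<longlongrightarrow> f (y 0)) (at 0)"
    by (simp add: continuous_on_def)
  have "continuous_on UNIV (\<lambda>s. g (y s))"
    unfolding g_def using assms(3) by (intro continuous_intros continuous_on_eval_mpoly y) auto
  then have g: "((\<lambda>s. g (y s)) \<longlongrightarrow> g (y 0)) (at 0)"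
    by (simp add: continuous_on_def)
  have "\<forall>\<^sub>F s in at 0. g (y s) = f (y s)"
    using eventually_inj_on_perturb[of z N]
  proof (rule eventually_mono)
    show "g (y s) = f (y s)" if "inj_on (\<lambda>j. z j + s * of_nat j) {1..N}" for s
      unfolding f_def g_def y_def
      by (rule dual_wavefunction_distinct[OF assms(2-5) that, symmetric])
  qed
  from Lim_transform_eventually[OF g this] have "((\<lambda>s. f (y s)) \<longlongrightarrow> g (y 0)) (at 0)" .
  then have "f (y 0) = g (y 0)"
    using f by (intro tendsto_unique[of "at 0"]) auto
  then show ?thesis by (simp add: f_def g_def y_def)
qed

end
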